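(* For every integer $d \geq 2$ there are strictly negative real numbers $\alpha_1, \ldots, \alpha_{d-2}$ such that the following holds. For every sequence $(a_n)_{n \geq 0}$ of real numbers with $a_0 = 1$ and $a_n \geq 0$ for all sufficiently large $n$, whose generating series satisfies $\sum_{n \geq 0} a_n t^n = \frac{h(t)}{(1-t)^d}$ for some polynomial $h(t)$ with $h(1) \neq 0$, there are a number $R > 0$ and sequences of complex numbers $(\beta_r^{(i)})_{r \geq 1}$, $1 \leq i \leq d$, such that: (i) $\beta_r^{(i)}$ is real for $r > R$ and $1 \leq i \leq d$, and strictly negative for $r > R$ and $1 \leq i \leq d-1$; (ii) $\beta_r^{(i)} \rightarrow \alpha_i$ as $r \rightarrow \infty$, for $1 \leq i \leq d-2$; (iii) $\beta_r^{(d-1)} \rightarrow -\infty$ as $r \rightarrow \infty$; (iv) $\beta_r^{(d)} \rightarrow 0$ as $r \rightarrow \infty$; (v) $h_0^{\langle r \rangle} + h_1^{\langle r \rangle} t + \cdots + h_d^{\langle r \rangle} t^d = \prod_{i=1}^d (1-\beta_r^{(i)} t)$.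
   Context: For an integer $r\ge 1$ and a sequence with $\sum_{n\ge 0} a_n t^n = h(t)/(1-t)^d$, $h(t)$ a polynomial, the series $\sum_{n\ge 0} a_{rn} t^n$ is also of the form $h^{\langle r\rangle}(t)/(1-t)^d$ for a (unique) polynomial $h^{\langle r\rangle}(t)$. The number $h_i^{\langle r\rangle}$ denotes the coefficient of $t^i$ in $h^{\langle r\rangle}(t)$. *)

theory Defs
  imports Complex_Main "HOL-Computational_Algebra.Computational_Algebra"
begin

definition fps_section :: "nat \<Rightarrow> 'a::zero fps \<Rightarrow> 'a fps" where
  "fps_section r F = Abs_fps (\<lambda>n. fps_nth F (r * n))"

text \<open>
  The polynomial \<open>h\<^sup>\<langle>\<^sup>r\<^sup>\<rangle>\<close>. It depends on the exponent \<open>d\<close> as well as on \<open>h\<close>; existence and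
  uniqueness for \<open>r \<ge> 1\<close> are shown in \<open>veronese_poly_ex1\<close>.
\<close>
definition veronese_poly :: "nat \<Rightarrow> nat \<Rightarrow> real poly \<Rightarrow> real poly" where
  "veronese_poly d r h =
     (THE g. fps_section r (fps_of_poly h / (1 - fps_X) ^ d) = fps_of_poly g / (1 - fps_X) ^ d)"

lemma fps_section_mult_X_power:
  fixes F :: "real fps"
  assumes "r \<ge> 1"
  shows "fps_section r (fps_X ^ r * F) = fps_X * fps_section r F"
proof (rule fps_ext)
  fix n
  show "fps_nth (fps_section r (fps_X ^ r * F)) n = fps_nth (fps_X * fps_section r F) n"
    using assms by (cases n) (auto simp: fps_section_def fps_X_power_mult_nth)
qed

lemma fps_section_diff:
  fixes F G :: "real fps"
  shows "fps_section r (F - G) = fps_section r F - fps_section r G"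
  by (rule fps_ext) (simp add: fps_section_def)

lemma fps_section_one_minus_power:
  fixes F :: "real fps"
  assumes "r \<ge> 1"
  shows "fps_section r ((1 - fps_X ^ r) ^ d * F) = (1 - fps_X) ^ d * fps_section r F"
proof (induction d)
  case (Suc d)
  have "(1 - fps_X ^ r) ^ Suc d * F
      = (1 - fps_X ^ r) ^ d * F - fps_X ^ r * ((1 - fps_X ^ r) ^ d * F)"
    by (simp add: algebra_simps)
  then have "fps_section r ((1 - fps_X ^ r) ^ Suc d * F)
      = (1 - fps_X) ^ d * fps_section r F - fps_X * ((1 - fps_X) ^ d * fps_section r F)"
    by (simp only: fps_section_diff fps_section_mult_X_power[OF assms] Suc.IH)
  then show ?case
    by (simp add: algebra_simps)
qed simp

lemma fps_section_of_poly:
  fixes p :: "real poly"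
  assumes "r \<ge> 1"
  shows "\<exists>g. fps_section r (fps_of_poly p) = fps_of_poly g"
proof -
  have z: "coeff p (r * n) = 0" if "n > degree p" for n
    by (rule coeff_eq_0) (use that assms in \<open>metis less_le_trans mult_le_mono1 mult_1\<close>)
  then have "\<forall>\<^sub>\<infinity>n. coeff p (r * n) = 0"
    unfolding MOST_nat by blast
  then have "fps_section r (fps_of_poly p) = fps_of_poly (Abs_poly (\<lambda>n. coeff p (r * n)))"
    by (intro fps_ext) (simp add: fps_section_def Abs_poly_inverse)
  then show ?thesis by blast
qed

lemma veronese_poly_ex1:
  fixes h :: "real poly"
  assumes r: "r \<ge> 1"
  shows "\<exists>!g. fps_section r (fps_of_poly h / (1 - fps_X) ^ d) = fps_of_poly g / (1 - fps_X) ^ d"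
proof -
  let ?D = "(1 - fps_X :: real fps) ^ d"
  let ?F = "fps_of_poly h / ?D"
  have D0: "fps_nth ?D 0 \<noteq> 0" by simp
  then have Dnz: "?D \<noteq> 0" by auto
  have canc: "G / ?D * ?D = G" for G
    using D0 by (simp add: fps_divide_unit mult.assoc inverse_mult_eq_1)
  have iff: "F = G / ?D \<longleftrightarrow> ?D * F = G" for F G
    using canc Dnz by (metis mult.commute mult_cancel_right)
  have geo: "(1 - fps_X ^ r :: real fps) = (\<Sum>i<r. fps_X ^ i) * (1 - fps_X)"
    using one_diff_power_eq[of "fps_X :: real fps" r] by (simp add: mult.commute)
  have "(1 - fps_X ^ r) ^ d * ?F = (\<Sum>i<r. fps_X ^ i) ^ d * (?F * ?D)"
    by (simp add: geo power_mult_distrib mult_ac del: fps_divide_times_eq)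
  also have "\<dots> = (\<Sum>i<r. fps_X ^ i) ^ d * fps_of_poly h"
    by (simp only: canc)
  also have "\<dots> = fps_of_poly ((\<Sum>i<r. monom 1 i) ^ d * h)"
    by (simp add: fps_of_poly_mult fps_of_poly_power fps_of_poly_sum fps_of_poly_monom)
  finally have "?D * fps_section r ?F = fps_section r (fps_of_poly ((\<Sum>i<r. monom 1 i) ^ d * h))"
    using fps_section_one_minus_power[OF r, of d ?F] by simp
  then obtain g where g: "?D * fps_section r ?F = fps_of_poly g"
    using fps_section_of_poly[OF r] by metis
  show ?thesis
    unfolding iff using g by (auto simp: fps_of_poly_eq_iff)
qed

end

theory Submission
  imports Defs
begin

text \<open>
  Put \<open>k = d - 1\<close>. The coefficients \<open>a n\<close> grow like \<open>c n\<^sup>k\<close> with \<open>c = h(1) / k!\<close>, and \<open>c > 0\<close> because the \<open>a n\<close> are eventually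
  nonnegative. Hence \<open>a (r n) / r\<^sup>k\<close> tends to \<open>c n\<^sup>k\<close> for each fixed \<open>n\<close>, also for \<open>n = 0\<close>, and the coefficients of
  \<open>h\<^bsup>\<langle>r\<rangle>\<^esup> / r\<^sup>k\<close>, being fixed linear combinations of these numbers, tend to those of \<open>c A\<^sub>k\<close>, where \<open>A\<^sub>k\<close> is the Eulerian
  polynomial defined by \<open>\<Sum>n. n\<^sup>k t\<^sup>n = A\<^sub>k(t) / (1 - t)\<^bsup>k+1\<^esup>\<close> (\<open>veronese_coeff_limit\<close>).

  By a theorem of Frobenius, \<open>A\<^sub>k\<close> has degree \<open>k\<close> and \<open>k\<close> distinct zeros: \<open>0\<close> and \<open>k - 1 = d - 2\<close> negative ones. In the
  variable \<open>s = 1/(1 - t)\<close> this is an induction with Rolle's theorem (\<open>eulerian_poly_real_rooted\<close>). The \<open>\<alpha> i\<close> are the reciprocals of the negative zeros. As simple real zeros persist under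
  perturbation (\<open>roots_of_rescaled_polys\<close>), for large \<open>r\<close> the polynomial \<open>h\<^bsup>\<langle>r\<rangle>\<^esup>\<close>, cut off at degree \<open>d\<close>, has real zeros close to all zeros of
  \<open>A\<^sub>k\<close>, and their reciprocals are the first \<open>d - 1\<close> of the \<open>\<beta> i\<close>. The zero close to \<open>0\<close> must be negative since
  \<open>h\<^bsup>\<langle>r\<rangle>\<^esup>\<close> is \<open>1\<close> at \<open>0\<close> and has a large positive coefficient at \<open>t\<close>; its reciprocal tends to \<open>-\<infinity>\<close>. What is left is
  one linear factor, whose coefficient is computed from the other zeros and the coefficient
  of \<open>t\<^sup>d\<close> (\<open>factor_over_given_roots\<close>). It tends to \<open>0\<close> because \<open>A\<^sub>k\<close> has degree below \<open>d\<close>.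
\<close>

section \<open>Eulerian polynomials and their zeros\<close>

text \<open>
  The recursion is the one forced by \<open>t d/dt (\<Sum>n. n\<^sup>k t\<^sup>n) = \<Sum>n. n\<^bsup>k+1\<^esup> t\<^sup>n\<close>, so that these are the numerators of
  \<open>\<Sum>n. n\<^sup>k t\<^sup>n\<close> over the denominator \<open>(1 - t)\<^bsup>k+1\<^esup>\<close>. For \<open>k \<ge> 1\<close> they carry the factor \<open>t\<close> that some authors
  divide out.
\<close>
primrec eulerian_poly :: "nat \<Rightarrow> real poly" where
  "eulerian_poly 0 = 1"
| "eulerian_poly (Suc k) =
     [:0, 1:] * ([:1, -1:] * pderiv (eulerian_poly k) + of_nat (Suc k) * eulerian_poly k)"

lemma fps_of_eulerian_poly:
  "fps_of_poly (eulerian_poly k) = (1 - fps_X) ^ Suc k * Abs_fps (\<lambda>n. real n ^ k)"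
proof (induction k)
  case 0
  show ?case
    by (rule fps_ext) (simp add: left_diff_distrib split: nat.split)
next
  case (Suc k)
  let ?F = "Abs_fps (\<lambda>n. real n ^ k)" and ?G = "Abs_fps (\<lambda>n. real n ^ Suc k)"
  let ?Y = "1 - fps_X :: real fps"
  have shift: "?G = fps_X * fps_deriv ?F"
    by (rule fps_ext) (simp add: of_nat_diff)
  have "fps_deriv (fps_of_poly (eulerian_poly k))
      = ?Y ^ Suc k * fps_deriv ?F - of_nat (Suc k) * ?Y ^ k * ?F"
    unfolding Suc.IH by (simp add: fps_deriv_power' del: power_Suc of_nat_Suc)
  moreover have "fps_of_poly (of_nat m :: real poly) = of_nat m" for m
    by (simp add: of_nat_poly fps_of_poly_const fps_of_nat)
  moreover have "fps_of_poly [:1, -1:] = ?Y"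
    by (simp add: fps_of_poly_linear')
  ultimately have "fps_of_poly (eulerian_poly (Suc k)) =
      fps_X * (?Y * (?Y ^ Suc k * fps_deriv ?F - of_nat (Suc k) * ?Y ^ k * ?F)
        + of_nat (Suc k) * (?Y ^ Suc k * ?F))"
    by (simp add: fps_of_poly_mult fps_of_poly_add fps_of_poly_pderiv Suc.IH
        del: of_nat_Suc power_Suc mult_pCons_left fps_deriv_mult)
  also have "\<dots> = ?Y ^ Suc (Suc k) * (fps_X * fps_deriv ?F)"
    by (simp add: algebra_simps)
  finally show ?case
    by (simp only: shift)
qed

lemma degree_eulerian_poly_le: "degree (eulerian_poly k) \<le> k"
proof (induction k)
  case (Suc k)
  have "degree ([:1, -1:] * pderiv (eulerian_poly k)) \<le> k"
  proof (cases "pderiv (eulerian_poly k) = 0")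
    case False
    then have "degree (eulerian_poly k) \<noteq> 0"
      by (simp add: pderiv_eq_0_iff)
    then show ?thesis
      using Suc degree_mult_le[of "[:1, -1:]" "pderiv (eulerian_poly k)"] by (simp add: degree_pderiv del: mult_pCons_left)
  qed simp
  moreover have "degree (of_nat (Suc k) * eulerian_poly k) \<le> k"
    using Suc degree_mult_le[of "of_nat (Suc k)" "eulerian_poly k"] by (simp del: of_nat_Suc)
  ultimately have "degree ([:1, -1:] * pderiv (eulerian_poly k) + of_nat (Suc k) * eulerian_poly k) \<le> k"
    by (rule degree_add_le)
  then show ?case
    using degree_pCons_le[of 0] by (simp del: of_nat_Suc)
qed simp

lemma coeff_eulerian_poly:
  "coeff (eulerian_poly k) i = (\<Sum>j=0..i. fps_nth ((1 - fps_X) ^ Suc k) j * real (i - j) ^ k)"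
  by (simp add: fps_of_eulerian_poly fps_mult_nth flip: fps_of_poly_nth del: power_Suc)

lemma coeff_1_eulerian_poly: "k \<ge> 1 \<Longrightarrow> coeff (eulerian_poly k) 1 = 1"
  by (simp add: coeff_eulerian_poly fps_nth_power_0 del: power_Suc)

text \<open>
  The series \<open>\<Sum>n. n\<^sup>k t\<^sup>n\<close> as a polynomial in \<open>s = 1/(1 - t)\<close>: in this variable the operator \<open>t d/dt\<close> becomes
  \<open>s (s - 1) d/ds\<close>. The half-line \<open>t \<le> 0\<close> corresponds to \<open>0 < s \<le> 1\<close>, and \<open>t = -\<infinity>\<close> to the ordinary point \<open>s = 0\<close>,
  so that Rolle's theorem also sees the zero at infinity.
\<close>
primrec geom_eulerian_poly :: "nat \<Rightarrow> real poly" where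
  "geom_eulerian_poly 0 = [:0, 1:]"
| "geom_eulerian_poly (Suc k) = [:0, -1, 1:] * pderiv (geom_eulerian_poly k)"

lemma poly_geom_eulerian_poly:
  "s > 0 \<Longrightarrow> poly (geom_eulerian_poly k) s = s ^ Suc k * poly (eulerian_poly k) (1 - 1 / s)"
proof (induction k arbitrary: s)
  case (Suc k)
  let ?P = "eulerian_poly k" and ?Q = "geom_eulerian_poly k"
  let ?t = "1 - 1 / s"
  have "((\<lambda>u. u ^ Suc k * poly ?P (1 - 1 / u)) has_real_derivative
      real (Suc k) * s ^ k * poly ?P ?t + s ^ Suc k * (poly (pderiv ?P) ?t * (1 / s\<^sup>2))) (at s)"
    using Suc.prems
    by (auto intro!: derivative_eq_intros DERIV_chain2[OF poly_DERIV] simp: power2_eq_square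
        simp del: power_Suc of_nat_Suc)
  moreover have "((\<lambda>u. u ^ Suc k * poly ?P (1 - 1 / u)) has_real_derivative poly (pderiv ?Q) s) (at s)"
  proof (rule has_field_derivative_transform_within_open[OF poly_DERIV])
    show "poly ?Q x = x ^ Suc k * poly ?P (1 - 1 / x)" if "x \<in> {0<..}" for x
      using Suc.IH that by simp
  qed (use Suc.prems in auto)
  ultimately have "poly (pderiv ?Q) s
      = real (Suc k) * s ^ k * poly ?P ?t + s ^ Suc k * (poly (pderiv ?P) ?t * (1 / s\<^sup>2))"
    by (rule DERIV_unique[rotated])
  moreover have "s * (s - 1) * (real (Suc k) * s ^ k * u + s ^ Suc k * (v * (1 / s\<^sup>2)))
      = s ^ Suc (Suc k) * ((1 - 1 / s) * (1 / s * v + real (Suc k) * u))" for u v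
    using Suc.prems by (simp add: field_simps power2_eq_square)
  moreover have "poly (geom_eulerian_poly (Suc k)) s = s * (s - 1) * poly (pderiv ?Q) s"
    by (simp add: algebra_simps)
  moreover have "poly (eulerian_poly (Suc k)) ?t
      = ?t * (1 / s * poly (pderiv ?P) ?t + real (Suc k) * poly ?P ?t)"
    by (simp add: algebra_simps)
  ultimately show ?case
    by (simp only:)
qed simp

text \<open>
  Between two consecutive zeros Rolle's theorem gives a zero of the derivative, and the factor \<open>s (s - 1)\<close> of the
  recursion puts the end points \<open>0\<close> and \<open>1\<close> back: each step gains exactly one zero.
\<close>
lemma geom_eulerian_poly_real_rooted:
  "\<exists>s :: nat \<Rightarrow> real. s 0 = 0 \<and> s (Suc k) = 1 \<and> (\<forall>i\<le>k. s i < s (Suc i)) \<and>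
     (\<forall>i\<le>Suc k. poly (geom_eulerian_poly (Suc k)) (s i) = 0)"
proof (induction k)
  case 0
  show ?case
    by (rule exI[of _ real]) (auto simp: le_Suc_eq)
next
  case (Suc k)
  let ?Q = "geom_eulerian_poly (Suc k)"
  obtain s where s: "s 0 = 0" "s (Suc k) = 1" "\<And>i. i \<le> k \<Longrightarrow> s i < s (Suc i)"
    "\<And>i. i \<le> Suc k \<Longrightarrow> poly ?Q (s i) = 0"
    using Suc.IH by blast
  have "\<exists>z. s i < z \<and> z < s (Suc i) \<and> poly (pderiv ?Q) z = 0" if "i \<le> k" for i
    using poly_MVT[OF s(3)[OF that], of ?Q] s(3)[OF that] s(4)[of i] s(4)[of "Suc i"] that by auto
  then obtain z where z: "\<And>i. i \<le> k \<Longrightarrow> s i < z i \<and> z i < s (Suc i) \<and> poly (pderiv ?Q) (z i) = 0"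
    by metis
  define s' where "s' i = (if i = 0 then 0 else if i = Suc (Suc k) then 1 else z (i - 1))" for i
  have "s' i < s' (Suc i)" if "i \<le> Suc k" for i
  proof (cases i)
    case 0
    then show ?thesis
      using z[of 0] s(1) by (simp add: s'_def)
  next
    case (Suc j)
    then have "z j < s (Suc j)" "Suc j \<le> k \<Longrightarrow> s (Suc j) < z (Suc j)"
      using z that by auto
    then show ?thesis
      using Suc s(2) that by (cases "j = k") (auto simp: s'_def)
  qed
  moreover have "poly (geom_eulerian_poly (Suc (Suc k))) (s' i) = 0" if "i \<le> Suc (Suc k)" for i
    using z[of "i - 1"] that by (auto simp: s'_def)
  ultimately show ?case
    by (intro exI[of _ s']) (auto simp: s'_def)
qed

text \<open>
  The zeros \<open>s > 0\<close> of the polynomial in \<open>s = 1/(1 - t)\<close> are carried back by \<open>t = 1 - 1/s\<close>; the zero \<open>s = 1\<close>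
  becomes \<open>t = 0\<close>. It gets the index \<open>k\<close>, since the corresponding \<open>\<beta>\<close> is the one that diverges.
\<close>
lemma eulerian_poly_real_rooted:
  assumes "k \<ge> 1"
  shows "\<exists>x :: nat \<Rightarrow> real. inj_on x {1..k} \<and> (\<forall>i\<in>{1..<k}. x i < 0) \<and> x k = 0 \<and>
     (\<forall>i\<in>{1..k}. poly (eulerian_poly k) (x i) = 0)"
proof -
  obtain m where k: "k = Suc m"
    using assms by (cases k) auto
  obtain s where s: "s 0 = 0" "s k = 1" "\<And>i. i < k \<Longrightarrow> s i < s (Suc i)"
    "\<And>i. i \<le> k \<Longrightarrow> poly (geom_eulerian_poly k) (s i) = 0"
    using geom_eulerian_poly_real_rooted[of m] by (auto simp: k less_Suc_eq_le)
  have mono: "s i < s j" if "i < j" "j \<le> k" for i j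
    using that
  proof (induction j)
    case (Suc j)
    then show ?case
      using s(3)[of j] by (cases "i = j") auto
  qed simp
  have pos: "s i > 0" if "i \<in> {1..k}" for i
    using mono[of 0 i] s(1) that by auto
  define x where "x i = 1 - 1 / s i" for i
  have "inj_on x {1..k}"
  proof (rule inj_onI)
    fix i j assume "i \<in> {1..k}" "j \<in> {1..k}" "x i = x j"
    then show "i = j"
      using mono[of i j] mono[of j i] by (cases i j rule: linorder_cases) (auto simp: x_def)
  qed
  moreover have "x i < 0" if "i \<in> {1..<k}" for i
    using mono[of i k] pos[of i] s(2) that by (simp add: x_def)
  moreover have "poly (eulerian_poly k) (x i) = 0" if "i \<in> {1..k}" for i
    using poly_geom_eulerian_poly[OF pos[OF that], of k] s(4)[of i] pos[OF that] that
    by (simp add: x_def)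
  ultimately show ?thesis
    using s(2) by (intro exI[of _ x]) (auto simp: x_def)
qed

section \<open>Rescaled coefficients of the Veronese polynomials\<close>

lemma binomial_asymptotic:
  "(\<lambda>n. real ((n + m) choose m) / real (n + j) ^ m) \<longlonglongrightarrow> 1 / fact m"
proof (induction m)
  case (Suc m)
  have ratio: "(\<lambda>n. real (n + Suc m) / real (n + j)) \<longlonglongrightarrow> 1"
  proof (rule Lim_transform_eventually)
    show "(\<lambda>n. 1 + (real (Suc m) - real j) / real (n + j)) \<longlonglongrightarrow> 1"
      using tendsto_add[OF tendsto_const[of 1]
          LIMSEQ_ignore_initial_segment[OF lim_const_over_n, of "real (Suc m) - real j" j]] by simp
    show "\<forall>\<^sub>F n in sequentially. 1 + (real (Suc m) - real j) / real (n + j) = real (n + Suc m) / real (n + j)"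
      using eventually_gt_at_top[of 0] by eventually_elim (simp add: field_simps)
  qed
  have "real ((n + Suc m) choose Suc m) = real ((n + m) choose m) * real (n + Suc m) / real (Suc m)" for n
  proof -
    have "Suc m * ((n + Suc m) choose Suc m) = (n + Suc m) * ((n + m) choose m)"
      using Suc_times_binomial[of m "n + m"] by simp
    then have "real (Suc m) * real ((n + Suc m) choose Suc m) = real (n + Suc m) * real ((n + m) choose m)"
      by (simp only: of_nat_mult[symmetric])
    then show ?thesis
      by (simp add: field_simps)
  qed
  then have "(\<lambda>n. real ((n + Suc m) choose Suc m) / real (n + j) ^ Suc m)
      = (\<lambda>n. real ((n + m) choose m) / real (n + j) ^ m * (real (n + Suc m) / real (n + j)) / real (Suc m))"
    by (auto simp: fun_eq_iff)
  moreover have "\<dots> \<longlonglongrightarrow> 1 / fact m * 1 / real (Suc m)"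
    by (intro tendsto_divide tendsto_mult tendsto_const Suc ratio) auto
  ultimately show ?case
    by (simp add: field_simps)
qed simp

lemma coeff_asymptotic_over_one_minus_X_power:
  fixes a :: "nat \<Rightarrow> real" and h :: "real poly"
  assumes "Abs_fps a = fps_of_poly h / (1 - fps_X) ^ Suc k"
  shows "(\<lambda>n. a n / real n ^ k) \<longlonglongrightarrow> poly h 1 / fact k"
proof -
  let ?u = "\<lambda>j n. if j \<le> n then real ((n - j + k) choose k) else 0"
  have inv: "inverse ((1 - fps_X) ^ Suc k) = Abs_fps (\<lambda>n. real ((n + k) choose k))"
  proof -
    have "(Suc k + n - 1) choose n = (n + k) choose k" for n
      using binomial_symmetric[of n "n + k"] by (simp add: add.commute)
    then show ?thesis
      using one_minus_const_fps_X_neg_power'[of "Suc k" "1 :: real"] by simp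
  qed
  have "Abs_fps a = fps_of_poly h * Abs_fps (\<lambda>n. real ((n + k) choose k))"
    unfolding assms inv[symmetric] by (rule fps_divide_unit) simp
  from arg_cong[OF this, of "\<lambda>F. fps_nth F n" for n]
  have a: "a n = (\<Sum>j=0..n. coeff h j * real ((n - j + k) choose k))" for n
    by (simp add: fps_mult_nth)
  have a': "a n = (\<Sum>j\<le>degree h. coeff h j * ?u j n)" for n
  proof -
    have "a n = (\<Sum>j\<in>{0..n} \<inter> {..degree h}. coeff h j * real ((n - j + k) choose k))"
      unfolding a by (rule sum.mono_neutral_right) (auto intro: coeff_eq_0)
    also have "\<dots> = (\<Sum>j\<in>{0..n} \<inter> {..degree h}. coeff h j * ?u j n)"
      by (rule sum.cong) auto
    also have "\<dots> = (\<Sum>j\<le>degree h. coeff h j * ?u j n)"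
      by (rule sum.mono_neutral_left) auto
    finally show ?thesis .
  qed
  have u: "(\<lambda>n. ?u j n / real n ^ k) \<longlonglongrightarrow> 1 / fact k" for j
    \<comment> \<open>Shifting by \<open>j\<close> turns \<open>n - j\<close> into \<open>n\<close> and \<open>n\<^sup>k\<close> into \<open>(n + j)\<^sup>k\<close>.\<close>
    by (rule LIMSEQ_offset[where k = j]) (use binomial_asymptotic[of k j] in simp)
  have "(\<lambda>n. \<Sum>j\<le>degree h. coeff h j * (?u j n / real n ^ k)) \<longlonglongrightarrow> (\<Sum>j\<le>degree h. coeff h j * (1 / fact k))"
    by (intro tendsto_sum tendsto_mult tendsto_const u)
  moreover have "(\<lambda>n. \<Sum>j\<le>degree h. coeff h j * (?u j n / real n ^ k)) = (\<lambda>n. a n / real n ^ k)"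
    by (simp add: a' sum_divide_distrib)
  moreover have "(\<Sum>j\<le>degree h. coeff h j * (1 / fact k)) = poly h 1 / fact k"
    by (simp add: poly_altdef sum_divide_distrib)
  ultimately show ?thesis
    by simp
qed

text \<open>
  The hypothesis \<open>k \<ge> 1\<close> is what makes the statement true at \<open>n = 0\<close>: there the sequence is \<open>a 0 / r\<^sup>k\<close> and
  has to tend to \<open>0\<close>. This is how the value \<open>a 0\<close>, which need not fit the growth of the other terms, disappears
  from the limit.
\<close>
lemma section_asymptotic:
  fixes a :: "nat \<Rightarrow> real"
  assumes "(\<lambda>n. a n / real n ^ k) \<longlonglongrightarrow> c" "k \<ge> 1"
  shows "(\<lambda>r. a (r * n) / real r ^ k) \<longlonglongrightarrow> c * real n ^ k"
proof (cases "n = 0")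
  case True
  have "(\<lambda>r. a 0 * inverse (real r) ^ k) \<longlonglongrightarrow> a 0 * 0 ^ k"
    by (intro tendsto_intros lim_inverse_n)
  then show ?thesis
    using True assms(2) by (simp add: field_simps zero_power)
next
  case False
  then have "strict_mono (\<lambda>r. r * n)"
    by (simp add: strict_mono_def)
  from LIMSEQ_subseq_LIMSEQ[OF assms(1) this]
  have "(\<lambda>r. a (r * n) / real (r * n) ^ k * real n ^ k) \<longlonglongrightarrow> c * real n ^ k"
    by (intro tendsto_mult tendsto_const) (simp add: o_def)
  then show ?thesis
    using False by (simp add: power_mult_distrib)
qed

lemma coeff_veronese_poly:
  assumes "Abs_fps a = fps_of_poly h / (1 - fps_X) ^ d" "r \<ge> 1"
  shows "coeff (veronese_poly d r h) i = (\<Sum>j=0..i. fps_nth ((1 - fps_X) ^ d) j * a (r * (i - j)))"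
proof -
  have "fps_section r (Abs_fps a) = fps_of_poly (veronese_poly d r h) / (1 - fps_X) ^ d"
    using theI'[OF veronese_poly_ex1[OF assms(2), of h d]] unfolding veronese_poly_def assms(1) .
  then have "(1 - fps_X) ^ d * fps_section r (Abs_fps a) = fps_of_poly (veronese_poly d r h)"
    by (simp add: fps_divide_unit mult.left_commute[of "(1 - fps_X) ^ d"] inverse_mult_eq_1')
  from arg_cong[OF this, of "\<lambda>F. fps_nth F i"] show ?thesis
    by (simp add: fps_mult_nth fps_section_def)
qed

text \<open>
  Both sides are the same alternating binomial sum, once over \<open>a (r n) / r\<^sup>k\<close> and once over its limit,
  a constant multiple of \<open>n\<^sup>k\<close>; the Eulerian polynomial appears because it is the numerator of \<open>\<Sum>n. n\<^sup>k t\<^sup>n\<close>.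
\<close>
lemma veronese_coeff_limit:
  assumes "Abs_fps a = fps_of_poly h / (1 - fps_X) ^ Suc k" "k \<ge> 1"
  shows "(\<lambda>r. coeff (veronese_poly (Suc k) r h) i / real r ^ k)
    \<longlonglongrightarrow> poly h 1 / fact k * coeff (eulerian_poly k) i"
proof (rule Lim_transform_eventually)
  let ?c = "poly h 1 / fact k" and ?e = "fps_nth ((1 - fps_X :: real fps) ^ Suc k)"
  have "(\<lambda>r. \<Sum>j=0..i. ?e j * (a (r * (i - j)) / real r ^ k))
      \<longlonglongrightarrow> (\<Sum>j=0..i. ?e j * (?c * real (i - j) ^ k))"
    using section_asymptotic[OF coeff_asymptotic_over_one_minus_X_power[OF assms(1)] assms(2)]
    by (intro tendsto_sum tendsto_mult tendsto_const)
  also have "(\<Sum>j=0..i. ?e j * (?c * real (i - j) ^ k)) = ?c * coeff (eulerian_poly k) i"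
    unfolding coeff_eulerian_poly sum_distrib_left by (simp only: mult.left_commute)
  finally show "(\<lambda>r. \<Sum>j=0..i. ?e j * (a (r * (i - j)) / real r ^ k))
      \<longlonglongrightarrow> ?c * coeff (eulerian_poly k) i" .
  show "\<forall>\<^sub>F r in sequentially. (\<Sum>j=0..i. ?e j * (a (r * (i - j)) / real r ^ k))
      = coeff (veronese_poly (Suc k) r h) i / real r ^ k"
    using eventually_ge_at_top[of 1]
    by eventually_elim (simp only: coeff_veronese_poly[OF assms(1)] sum_divide_distrib times_divide_eq_right)
qed

section \<open>Convergence of zeros\<close>

text \<open>
  The selection picks, at each \<open>n\<close>, a point whose distance to \<open>x\<close> exceeds the infimum over all candidates
  by less than \<open>1/(n+1)\<close>; so a single choice works for every \<open>e\<close>.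
\<close>
lemma exists_convergent_selection:
  fixes x :: "'a::metric_space"
  assumes "\<And>e. e > 0 \<Longrightarrow> \<forall>\<^sub>F n in sequentially. \<exists>y. dist y x < e \<and> P n y"
  shows "\<exists>\<xi>. \<xi> \<longlonglongrightarrow> x \<and> (\<forall>\<^sub>F n in sequentially. P n (\<xi> n))"
proof -
  define D where "D n = (INF y\<in>{y. P n y}. dist y x)" for n
  have bdd: "bdd_below ((\<lambda>y. dist y x) ` {y. P n y})" for n
    by (rule bdd_belowI[of _ 0]) auto
  have near: "\<exists>y. P n y \<and> dist y x < D n + 1 / real (Suc n)" if "\<exists>y. P n y" for n
    using cINF_less_iff[OF _ bdd, of n "D n + 1 / real (Suc n)"] that by (auto simp: D_def)
  define \<xi> where "\<xi> n = (SOME y. P n y \<and> dist y x < D n + 1 / real (Suc n))" for n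
  have \<xi>: "P n (\<xi> n) \<and> dist (\<xi> n) x < D n + 1 / real (Suc n)" if "\<exists>y. P n y" for n
    unfolding \<xi>_def by (rule someI_ex[OF near[OF that]])
  have "\<xi> \<longlonglongrightarrow> x"
  proof (rule tendstoI)
    fix e :: real assume "e > 0"
    have "\<forall>\<^sub>F n in sequentially. 1 / real (Suc n) < e / 2"
      using \<open>e > 0\<close> by (intro order_tendstoD(2)[OF lim_1_over_n[THEN LIMSEQ_Suc]]) auto
    with assms[OF half_gt_zero[OF \<open>e > 0\<close>]] show "\<forall>\<^sub>F n in sequentially. dist (\<xi> n) x < e"
    proof eventually_elim
      case (elim n)
      then obtain y where "dist y x < e / 2" "P n y"
        by blast
      moreover from this have "D n \<le> dist y x"
        unfolding D_def by (intro cINF_lower[OF bdd]) auto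
      ultimately show ?case
        using \<xi>[of n] elim(2) by fastforce
    qed
  qed
  moreover have "\<forall>\<^sub>F n in sequentially. P n (\<xi> n)"
    using assms[OF zero_less_one] by eventually_elim (use \<xi> in blast)
  ultimately show ?thesis
    by blast
qed

lemma simple_root_sign_change:
  fixes p :: "real poly"
  assumes "poly p x = 0" "poly (pderiv p) x \<noteq> 0" "e > 0"
  shows "\<exists>u v. u < v \<and> {u..v} \<subseteq> {x - e<..<x + e} \<and> poly p u * poly p v < 0"
proof -
  \<comment> \<open>Multiplying by the sign of the derivative makes the polynomial increasing at \<open>x\<close>.\<close>
  define q where "q = smult (sgn (poly (pderiv p) x)) p"
  have "poly (pderiv q) x = \<bar>poly (pderiv p) x\<bar>"
    by (simp add: q_def pderiv_smult abs_sgn mult.commute)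
  then have "DERIV (poly q) x :> \<bar>poly (pderiv p) x\<bar>"
    using poly_DERIV[of q x] by simp
  moreover have "\<bar>poly (pderiv p) x\<bar> > 0"
    using assms(2) by simp
  ultimately obtain d1 d2 where d: "d1 > 0" "\<And>h. 0 < h \<Longrightarrow> h < d1 \<Longrightarrow> poly q x < poly q (x + h)"
    "d2 > 0" "\<And>h. 0 < h \<Longrightarrow> h < d2 \<Longrightarrow> poly q (x - h) < poly q x"
    using DERIV_pos_inc_right[of "poly q"] DERIV_pos_inc_left[of "poly q"] by blast
  define h where "h = min (min d1 d2) e / 2"
  have h: "0 < h" "h < d1" "h < d2" "h < e"
    using d(1,3) assms(3) by (auto simp: h_def)
  then have "poly q (x - h) * poly q (x + h) < 0"
    using d(2)[of h] d(4)[of h] assms(1) by (auto simp: q_def mult_less_0_iff)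
  moreover have "poly q (x - h) * poly q (x + h) = poly p (x - h) * poly p (x + h)"
    using assms(2) by (simp add: q_def sgn_if)
  ultimately show ?thesis
    using h by (intro exI[of _ "x - h"] exI[of _ "x + h"]) auto
qed

lemma simple_root_limit_of_roots:
  fixes p :: "real poly"
  assumes "\<And>t. (\<lambda>n. poly (G n) t) \<longlonglongrightarrow> poly p t" "poly p x = 0" "poly (pderiv p) x \<noteq> 0"
  shows "\<exists>\<xi>. \<xi> \<longlonglongrightarrow> x \<and> (\<forall>\<^sub>F n in sequentially. poly (G n) (\<xi> n) = 0)"
proof (rule exists_convergent_selection)
  fix e :: real assume "e > 0"
  then obtain u v where uv: "u < v" "{u..v} \<subseteq> {x - e<..<x + e}" "poly p u * poly p v < 0"
    using simple_root_sign_change assms(2,3) by blast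
  have "(\<lambda>n. poly (G n) u * poly (G n) v) \<longlonglongrightarrow> poly p u * poly p v"
    by (intro tendsto_intros assms(1))
  from order_tendstoD(2)[OF this uv(3)]
  show "\<forall>\<^sub>F n in sequentially. \<exists>y. dist y x < e \<and> poly (G n) y = 0"
  proof eventually_elim
    case (elim n)
    then obtain y where "u < y" "y < v" "poly (G n) y = 0"
      using poly_IVT[OF uv(1)] by blast
    then show ?case
      using subsetD[OF uv(2), of y] by (intro exI[of _ y]) (auto simp: dist_real_def)
  qed
qed

text \<open>
  At a double zero the cofactor of \<open>t - x\<close> would vanish on all of \<open>S\<close>, although its degree is smaller than \<open>card S\<close>.
\<close>
lemma pderiv_nonzero_if_all_roots_distinct:
  fixes p :: "'a::idom poly"
  assumes "p \<noteq> 0" "finite S" "\<And>y. y \<in> S \<Longrightarrow> poly p y = 0" "degree p \<le> card S" "x \<in> S"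
  shows "poly (pderiv p) x \<noteq> 0"
proof
  assume "poly (pderiv p) x = 0"
  obtain q where q: "p = [:- x, 1:] * q"
    using assms(3)[OF assms(5)] by (auto simp: poly_eq_0_iff_dvd)
  then have "q \<noteq> 0"
    using assms(1) by auto
  have "poly q x = 0"
    using \<open>poly (pderiv p) x = 0\<close> by (simp add: q pderiv_mult pderiv_pCons del: mult_pCons_left)
  then have "S \<subseteq> {y. poly q y = 0}"
    using assms(3) by (auto simp: q)
  then have "card S \<le> degree q"
    using card_mono[OF poly_roots_finite[OF \<open>q \<noteq> 0\<close>]] card_poly_roots_bound[OF \<open>q \<noteq> 0\<close>] le_trans by blast
  moreover have "degree p = Suc (degree q)"
    using \<open>q \<noteq> 0\<close> unfolding q by (subst degree_mult_eq) auto
  ultimately show False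
    using assms(4) by simp
qed

lemma poly_altdef_le:
  fixes p :: "'a::comm_semiring_1 poly"
  assumes "degree p \<le> n"
  shows "poly p x = (\<Sum>i\<le>n. coeff p i * x ^ i)"
  unfolding poly_altdef
  by (rule sum.mono_neutral_left) (use assms in \<open>auto intro: le_degree\<close>)

text \<open>
  Every zero of the limit \<open>p\<close> is simple and hence the limit of real zeros of \<open>G r\<close>. At a negative zero of \<open>p\<close> this
  already gives the sign. At \<open>x k = 0\<close> the sign comes from \<open>G r 0 = 1\<close>: writing \<open>G r t = 1 + t \<rho> W\<close>, where \<open>W\<close>
  tends to the coefficient of \<open>t\<close> in \<open>p\<close>, shows that a zero near \<open>0\<close> is negative and behaves like \<open>-1/(\<rho> W)\<close>.
\<close>
lemma roots_of_rescaled_polys: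
  fixes G :: "nat \<Rightarrow> real poly" and p :: "real poly" and \<rho> :: "nat \<Rightarrow> real" and x :: "nat \<Rightarrow> real"
  assumes deg: "\<And>r. degree (G r) \<le> Suc k"
    and G0: "\<forall>\<^sub>F r in sequentially. coeff (G r) 0 = 1"
    and \<rho>: "filterlim \<rho> at_top sequentially"
    and conv: "\<And>i. (\<lambda>r. coeff (G r) i / \<rho> r) \<longlonglongrightarrow> coeff p i"
    and p: "degree p \<le> k" "coeff p 1 > 0"
    and x: "inj_on x {1..k}" "\<And>i. i \<in> {1..k} \<Longrightarrow> poly p (x i) = 0"
      "\<And>i. i \<in> {1..<k} \<Longrightarrow> x i < 0" "x k = 0" and k: "k \<ge> 1"
  obtains \<xi> :: "nat \<Rightarrow> nat \<Rightarrow> real" where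
    "\<And>i. i \<in> {1..k} \<Longrightarrow> \<xi> i \<longlonglongrightarrow> x i"
    "\<forall>\<^sub>F r in sequentially. (\<forall>i\<in>{1..k}. \<xi> i r < 0 \<and> poly (G r) (\<xi> i r) = 0) \<and> inj_on (\<lambda>i. \<xi> i r) {1..k}"
    "(\<lambda>r. \<rho> r * \<xi> k r) \<longlonglongrightarrow> - 1 / coeff p 1"
proof -
  have \<rho>_pos: "\<forall>\<^sub>F r in sequentially. \<rho> r > 0"
    using \<rho> by (simp add: filterlim_at_top_dense)
  have k_in: "k \<in> {1..k}"
    using k by simp
  have "p \<noteq> 0"
    using p(2) by auto
  have simple: "poly (pderiv p) (x i) \<noteq> 0" if "i \<in> {1..k}" for i
    using \<open>p \<noteq> 0\<close> by (rule pderiv_nonzero_if_all_roots_distinct[where S = "x ` {1..k}"])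
      (use x(1,2) p(1) that in \<open>auto simp: card_image\<close>)
  have ptw: "(\<lambda>r. poly (smult (1 / \<rho> r) (G r)) t) \<longlonglongrightarrow> poly p t" for t
  proof -
    have "(\<lambda>r. \<Sum>i\<le>Suc k. coeff (G r) i / \<rho> r * t ^ i) \<longlonglongrightarrow> (\<Sum>i\<le>Suc k. coeff p i * t ^ i)"
      by (intro tendsto_intros conv)
    then show ?thesis
      using poly_altdef_le[OF deg] poly_altdef_le[of p "Suc k"] p(1)
      by (simp add: sum_divide_distrib add_divide_distrib del: sum.atMost_Suc)
  qed
  have "\<exists>\<xi>. \<xi> \<longlonglongrightarrow> x i \<and> (\<forall>\<^sub>F r in sequentially. poly (smult (1 / \<rho> r) (G r)) (\<xi> r) = 0)"
    if "i \<in> {1..k}" for i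
    by (rule simple_root_limit_of_roots[OF ptw x(2)[OF that] simple[OF that]])
  then obtain \<xi> where \<xi>: "\<And>i. i \<in> {1..k} \<Longrightarrow> \<xi> i \<longlonglongrightarrow> x i"
    and scaled_root: "\<And>i. i \<in> {1..k} \<Longrightarrow>
      \<forall>\<^sub>F r in sequentially. poly (smult (1 / \<rho> r) (G r)) (\<xi> i r) = 0"
    by metis
  have root: "\<forall>\<^sub>F r in sequentially. poly (G r) (\<xi> i r) = 0" if "i \<in> {1..k}" for i
    using scaled_root[OF that] \<rho>_pos by eventually_elim simp
  define W where "W r = (\<Sum>i\<le>k. coeff (G r) (Suc i) / \<rho> r * \<xi> k r ^ i)" for r
  have "W \<longlonglongrightarrow> (\<Sum>i\<le>k. coeff p (Suc i) * 0 ^ i)"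
    unfolding W_def using \<xi>[of k] k x(4) by (intro tendsto_intros conv) auto
  also have "(\<Sum>i\<le>k. coeff p (Suc i) * 0 ^ i) = coeff p 1"
    by (subst sum.atMost_shift) simp
  finally have W: "W \<longlonglongrightarrow> coeff p 1" .
  have W_pos: "\<forall>\<^sub>F r in sequentially. W r > 0"
    using order_tendstoD(1)[OF W p(2)] .
  \<comment> \<open>The equation \<open>0 = 1 + \<xi> \<rho> W\<close> at the zero \<open>\<xi>\<close> next to the origin.\<close>
  have last: "\<forall>\<^sub>F r in sequentially. \<rho> r * \<xi> k r = - 1 / W r"
    using root[OF k_in] G0 \<rho>_pos W_pos
  proof eventually_elim
    case (elim r)
    have "\<rho> r * (\<xi> k r * W r) = \<xi> k r * (\<Sum>i\<le>k. coeff (G r) (Suc i) * \<xi> k r ^ i)"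
      using elim by (simp add: W_def sum_distrib_left)
    also have "1 + \<dots> = poly (G r) (\<xi> k r)"
      using elim by (simp add: poly_altdef_le[OF deg] sum.atMost_Suc_shift sum_distrib_left mult_ac del: sum.atMost_Suc)
    finally show ?case
      using elim by (simp add: field_simps)
  qed
  have neg: "\<forall>\<^sub>F r in sequentially. \<xi> i r < 0" if "i \<in> {1..k}" for i
  proof (cases "i = k")
    case True
    show ?thesis
      using last \<rho>_pos W_pos unfolding True
    proof eventually_elim
      case (elim r)
      then have "\<rho> r * \<xi> k r < 0"
        by simp
      then show ?case
        using elim(2) by (simp add: mult_less_0_iff)
    qed
  next
    case False
    then show ?thesis
      using order_tendstoD(2)[OF \<xi>[OF that], of 0] x(3)[of i] that by auto
  qed
  have distinct: "\<forall>\<^sub>F r in sequentially. \<xi> i r \<noteq> \<xi> j r" if "i \<in> {1..k}" "j \<in> {1..k}" "i \<noteq> j" for i j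
  proof -
    have "(\<lambda>r. \<xi> i r - \<xi> j r) \<longlonglongrightarrow> x i - x j"
      by (intro tendsto_intros \<xi> that)
    moreover have "x i - x j \<noteq> 0"
      using x(1) that by (auto dest: inj_onD)
    ultimately have "\<forall>\<^sub>F r in sequentially. \<xi> i r - \<xi> j r \<noteq> 0"
      by (rule tendsto_imp_eventually_ne)
    then show ?thesis
      by eventually_elim simp
  qed
  have "\<forall>\<^sub>F r in sequentially. \<forall>i\<in>{1..k}. \<forall>j\<in>{1..k}. i \<noteq> j \<longrightarrow> \<xi> i r \<noteq> \<xi> j r"
  proof (intro eventually_ball_finite ballI finite_atLeastAtMost)
    fix i j assume "i \<in> {1..k}" "j \<in> {1..k}"
    then show "\<forall>\<^sub>F r in sequentially. i \<noteq> j \<longrightarrow> \<xi> i r \<noteq> \<xi> j r"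
      using distinct[of i j] by (cases "i = j") simp_all
  qed
  then have "\<forall>\<^sub>F r in sequentially. inj_on (\<lambda>i. \<xi> i r) {1..k}"
    by eventually_elim (auto simp: inj_on_def)
  moreover have "\<forall>\<^sub>F r in sequentially. \<forall>i\<in>{1..k}. \<xi> i r < 0 \<and> poly (G r) (\<xi> i r) = 0"
    using neg root by (intro eventually_ball_finite ballI eventually_conj finite_atLeastAtMost)
  ultimately have "\<forall>\<^sub>F r in sequentially. (\<forall>i\<in>{1..k}. \<xi> i r < 0 \<and> poly (G r) (\<xi> i r) = 0) \<and> inj_on (\<lambda>i. \<xi> i r) {1..k}"
    by eventually_elim auto
  moreover have "(\<lambda>r. \<rho> r * \<xi> k r) \<longlonglongrightarrow> - 1 / coeff p 1"
  proof (rule Lim_transform_eventually)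
    show "(\<lambda>r. - 1 / W r) \<longlonglongrightarrow> - 1 / coeff p 1"
      using p(2) by (intro tendsto_intros W) auto
    show "\<forall>\<^sub>F r in sequentially. - 1 / W r = \<rho> r * \<xi> k r"
      using last by eventually_elim simp
  qed
  ultimately show ?thesis
    using that[of \<xi>] \<xi> by blast
qed

section \<open>Factorizations with constant term one\<close>

lemma divide_out_root:
  fixes p :: "'a::field poly"
  assumes "poly p z = 0" "coeff p 0 = 1"
  obtains q where "z \<noteq> 0" "p = [:1, - inverse z:] * q" "coeff q 0 = 1" "degree p = Suc (degree q)"
proof -
  have "z \<noteq> 0"
    using assms by (metis poly_0_coeff_0 zero_neq_one)
  obtain q where q: "p = [:- z, 1:] * q"
    using assms(1) by (auto simp: poly_eq_0_iff_dvd)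
  have "q \<noteq> 0"
    using q assms(2) by auto
  have "[:- z, 1:] = smult (- z) [:1, - inverse z:]"
    using \<open>z \<noteq> 0\<close> by simp
  then have "p = [:1, - inverse z:] * smult (- z) q"
    unfolding q by (metis mult_smult_left mult_smult_right)
  moreover have "degree p = Suc (degree (smult (- z) q))"
    using \<open>q \<noteq> 0\<close> \<open>z \<noteq> 0\<close> unfolding q by (subst degree_mult_eq) auto
  moreover have "coeff (smult (- z) q) 0 = 1"
    using assms(2) by (simp add: q)
  ultimately show ?thesis
    using that \<open>z \<noteq> 0\<close> by blast
qed

text \<open>
  One linear factor remains after the given zeros are split off, and comparison of the coefficients of top degree
  determines it. The limit of this factor can be read off from the explicit form, and so can the fact that it is real
  when \<open>p\<close> is real and the zeros are.
\<close>
lemma factor_over_given_roots: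
  fixes p :: "'a::field poly"
  assumes "finite A" "inj_on \<xi> A" "\<And>i. i \<in> A \<Longrightarrow> poly p (\<xi> i) = 0"
    "degree p \<le> Suc (card A)" "coeff p 0 = 1"
  shows "p = (\<Prod>i\<in>A. [:1, - inverse (\<xi> i):]) * [:1, coeff p (Suc (card A)) * (\<Prod>i\<in>A. - \<xi> i):]"
  using assms
proof (induction A arbitrary: p rule: finite_induct)
  case empty
  then have "p = [:1, coeff p 1:]"
    by (intro poly_eqI) (auto simp: coeff_pCons coeff_eq_0 split: nat.split)
  then show ?case
    by simp
next
  case (insert a A)
  obtain q where q: "\<xi> a \<noteq> 0" "p = [:1, - inverse (\<xi> a):] * q" "coeff q 0 = 1" "degree p = Suc (degree q)"
    using divide_out_root[of p "\<xi> a"] insert.prems by blast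
  have deg_q: "degree q \<le> Suc (card A)"
    using insert.prems(3) insert.hyps q(4) by simp
  have "poly q (\<xi> i) = 0" if "i \<in> A" for i
  proof -
    have "\<xi> i \<noteq> \<xi> a"
      using insert.prems(1) insert.hyps that inj_onD[of \<xi> "insert a A" i a] by blast
    then have "poly [:1, - inverse (\<xi> a):] (\<xi> i) \<noteq> 0"
      using q(1) by (simp add: field_simps)
    then show ?thesis
      using insert.prems(2)[of i] that unfolding q(2) poly_mult by simp
  qed
  then have IH: "q = (\<Prod>i\<in>A. [:1, - inverse (\<xi> i):]) * [:1, coeff q (Suc (card A)) * (\<Prod>i\<in>A. - \<xi> i):]"
    using insert.IH[of q] insert.prems(1) deg_q q(3) by simp
  have "coeff p (Suc (Suc (card A))) = - inverse (\<xi> a) * coeff q (Suc (card A))"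
    using deg_q by (simp add: q(2) coeff_eq_0)
  then have "coeff p (Suc (card (insert a A))) * (\<Prod>i\<in>insert a A. - \<xi> i)
      = coeff q (Suc (card A)) * (\<Prod>i\<in>A. - \<xi> i)"
    using insert.hyps q(1) by simp
  moreover have "p = (\<Prod>i\<in>insert a A. [:1, - inverse (\<xi> i):]) * [:1, coeff q (Suc (card A)) * (\<Prod>i\<in>A. - \<xi> i):]"
    unfolding prod.insert[OF insert.hyps] by (subst q(2), subst IH) (simp only: mult.assoc)
  ultimately show ?case
    by simp
qed

text \<open>
  The number of factors is prescribed and may exceed the degree: the missing ones are filled up with \<open>\<beta> i = 0\<close>.
\<close>
lemma complex_factorization:
  fixes p :: "complex poly"
  assumes "coeff p 0 = 1" "degree p \<le> n"
  shows "\<exists>\<beta>. p = (\<Prod>i=1..n. [:1, - \<beta> i:])"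
  using assms
proof (induction n arbitrary: p)
  case 0
  then have "p = 1"
    by (intro poly_eqI) (auto simp: coeff_eq_0)
  then show ?case
    by simp
next
  case (Suc n)
  show ?case
  proof (cases "degree p = 0")
    case True
    then have "p = 1"
      using Suc.prems(1) by (intro poly_eqI) (auto simp: coeff_eq_0)
    then show ?thesis
      by (intro exI[of _ "\<lambda>_. 0"]) (simp flip: one_pCons)
  next
    case False
    then obtain z where "poly p z = 0"
      using fundamental_theorem_of_algebra[of p] by (auto simp: constant_degree)
    then obtain q where q: "p = [:1, - inverse z:] * q" "coeff q 0 = 1" "degree p = Suc (degree q)"
      using divide_out_root Suc.prems(1) by blast
    then obtain \<beta> where \<beta>: "q = (\<Prod>i=1..n. [:1, - \<beta> i:])"
      using Suc.IH[of q] Suc.prems(2) by auto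
    have "(\<Prod>i=1..n. [:1, - (\<beta>(Suc n := inverse z)) i:]) = q"
      unfolding \<beta> by (rule prod.cong) auto
    then show ?thesis
      by (intro exI[of _ "\<beta>(Suc n := inverse z)"])
        (simp add: q(1) mult.commute[of q] prod.nat_ivl_Suc' del: mult_pCons_left fun_upd_apply, simp)
  qed
qed

section \<open>The factorization of the Veronese polynomials\<close>

text \<open>
  The limits \<open>1 / x i\<close> depend on \<open>k\<close> only, as the zeros of the Eulerian polynomial do. The numbers \<open>\<beta> 1, \<dots>, \<beta> k\<close> are the
  reciprocals of the zeros of \<open>h\<^bsup>\<langle>r\<rangle>\<^esup>\<close> that approach the \<open>x i\<close>, and the last one is what remains.
\<close>
lemma veronese_poly_factorization:
  fixes a :: "nat \<Rightarrow> real" and h :: "real poly" and x :: "nat \<Rightarrow> real"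
  assumes k: "k \<ge> 1" "d = Suc k"
    and x: "inj_on x {1..k}" "\<And>i. i \<in> {1..<k} \<Longrightarrow> x i < 0" "x k = 0"
      "\<And>i. i \<in> {1..k} \<Longrightarrow> poly (eulerian_poly k) (x i) = 0"
    and a0: "a 0 = 1" and a_nonneg: "\<forall>\<^sub>F n in sequentially. a n \<ge> 0"
    and a_h: "Abs_fps a = fps_of_poly h / (1 - fps_X) ^ d" and h1: "poly h 1 \<noteq> 0"
  shows "\<exists>(R :: real) (\<beta> :: nat \<Rightarrow> nat \<Rightarrow> complex). R > 0 \<and>
      (\<forall>r\<ge>1. real r > R \<longrightarrow>
         (\<forall>i\<in>{1..d}. \<beta> i r \<in> \<real>) \<and> (\<forall>i\<in>{1..d-1}. Re (\<beta> i r) < 0)) \<and>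
      (\<forall>i\<in>{1..d-2}. \<beta> i \<longlonglongrightarrow> complex_of_real (inverse (x i))) \<and>
      filterlim (\<lambda>r. Re (\<beta> (d-1) r)) at_bot sequentially \<and>
      \<beta> d \<longlonglongrightarrow> 0 \<and>
      (\<forall>r\<ge>1. (\<Sum>i=0..d. monom (complex_of_real (coeff (veronese_poly d r h) i)) i)
              = (\<Prod>i=1..d. [:1, - \<beta> i r:]))"
proof -
  have k_in: "k \<in> {1..k}"
    using k(1) by simp
  define c where "c = poly h 1 / fact k"
  have a_lim: "(\<lambda>n. a n / real n ^ k) \<longlonglongrightarrow> c"
    unfolding c_def by (rule coeff_asymptotic_over_one_minus_X_power[OF a_h[unfolded k(2)]])
  have "c \<ge> 0"
    by (rule tendsto_lowerbound[OF a_lim]) (use a_nonneg in \<open>auto elim: eventually_mono\<close>)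
  then have c: "c > 0"
    using h1 by (simp add: c_def order_less_le)
  \<comment> \<open>\<open>G r\<close> is \<open>h\<^bsup>\<langle>r\<rangle>\<^esup>\<close> cut off at degree \<open>d\<close>, and \<open>H r\<close> below is the same polynomial over the complex numbers.\<close>
  define G where "G r = (\<Sum>i=0..d. monom (coeff (veronese_poly d r h) i) i)" for r
  have coeff_G: "coeff (G r) i = (if i \<le> d then coeff (veronese_poly d r h) i else 0)" for r i
    by (simp add: G_def coeff_sum)
  have deg_G: "degree (G r) \<le> Suc k" for r
    by (rule degree_le) (simp add: coeff_G k(2))
  have G0: "coeff (G r) 0 = 1" if "r \<ge> 1" for r
    using coeff_veronese_poly[OF a_h that, of 0] a0 by (simp add: coeff_G fps_nth_power_0)
  have G_lim: "(\<lambda>r. coeff (G r) i / real r ^ k) \<longlonglongrightarrow> coeff (smult c (eulerian_poly k)) i" for i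
  proof (cases "i \<le> d")
    case True
    then show ?thesis
      using veronese_coeff_limit[OF a_h[unfolded k(2)] k(1), of i]
      unfolding coeff_G coeff_smult c_def k(2) by (simp only: if_True)
  next
    case False
    then have "coeff (eulerian_poly k) i = 0"
      using degree_eulerian_poly_le[of k] k(2) by (intro coeff_eq_0) simp
    then show ?thesis
      using False by (simp add: coeff_G)
  qed
  have \<rho>: "filterlim (\<lambda>r. real r ^ k) at_top sequentially"
    by (rule filterlim_pow_at_top[OF _ filterlim_real_sequentially]) (use k(1) in simp)
  have deg_p: "degree (smult c (eulerian_poly k)) \<le> k"
    using degree_eulerian_poly_le[of k] by simp
  have p1: "coeff (smult c (eulerian_poly k)) 1 > 0"
    using coeff_1_eulerian_poly[OF k(1)] c by simp
  have G0': "\<forall>\<^sub>F r in sequentially. coeff (G r) 0 = 1"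
    using eventually_ge_at_top[of 1] by eventually_elim (rule G0)
  have p_roots: "poly (smult c (eulerian_poly k)) (x i) = 0" if "i \<in> {1..k}" for i
    using x(4)[OF that] by simp
  obtain \<xi> where \<xi>: "\<And>i. i \<in> {1..k} \<Longrightarrow> \<xi> i \<longlonglongrightarrow> x i"
    and \<xi>_ev: "\<forall>\<^sub>F r in sequentially. (\<forall>i\<in>{1..k}. \<xi> i r < 0 \<and> poly (G r) (\<xi> i r) = 0) \<and>
      inj_on (\<lambda>i. \<xi> i r) {1..k}"
    and \<xi>_k: "(\<lambda>r. real r ^ k * \<xi> k r) \<longlonglongrightarrow> - 1 / coeff (smult c (eulerian_poly k)) 1"
    using roots_of_rescaled_polys[OF deg_G G0' \<rho> G_lim deg_p p1 x(1) p_roots x(2,3) k(1)] by blast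
  obtain N where N: "\<And>r i. r \<ge> N \<Longrightarrow> i \<in> {1..k} \<Longrightarrow> \<xi> i r < 0 \<and> poly (G r) (\<xi> i r) = 0"
    "\<And>r. r \<ge> N \<Longrightarrow> inj_on (\<lambda>i. \<xi> i r) {1..k}"
    using \<xi>_ev unfolding eventually_sequentially by blast
  \<comment> \<open>From \<open>N\<close> on the zeros are real, negative and distinct; the successor also ensures \<open>r \<ge> 1\<close>, which is needed for
    \<open>G r\<close> to have constant term \<open>1\<close>, and makes the bound positive.\<close>
  define M where "M = Suc N"
  define b where "b r = - (coeff (G r) d * (\<Prod>i=1..k. - \<xi> i r))" for r
  define H where "H r = (\<Sum>i=0..d. monom (complex_of_real (coeff (veronese_poly d r h) i)) i)" for r
  have coeff_H: "coeff (H r) i = complex_of_real (coeff (G r) i)" for r i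
    by (simp add: H_def coeff_G coeff_sum)
  have deg_H: "degree (H r) \<le> d" for r
    by (rule degree_le) (simp add: coeff_H coeff_G)
  have poly_H: "poly (H r) (complex_of_real t) = complex_of_real (poly (G r) t)" for r t
    unfolding poly_altdef_le[OF deg_H] poly_altdef_le[OF deg_G] k(2) coeff_H by simp
  have factor_real: "H r = (\<Prod>i=1..k. [:1, - complex_of_real (inverse (\<xi> i r)):]) * [:1, - complex_of_real (b r):]"
    if r: "r \<ge> M" for r
  proof -
    have r': "r \<ge> N" "r \<ge> 1"
      using r by (auto simp: M_def)
    have "H r = (\<Prod>i=1..k. [:1, - inverse (complex_of_real (\<xi> i r)):])
        * [:1, coeff (H r) (Suc (card {1..k})) * (\<Prod>i=1..k. - complex_of_real (\<xi> i r)):]"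
    proof (rule factor_over_given_roots[of "{1..k}" "\<lambda>i. complex_of_real (\<xi> i r)" "H r"])
      show "inj_on (\<lambda>i. complex_of_real (\<xi> i r)) {1..k}"
        by (rule inj_onI, rule inj_onD[OF N(2)[OF r'(1)]]) simp_all
      show "poly (H r) (complex_of_real (\<xi> i r)) = 0" if "i \<in> {1..k}" for i
        using N(1)[OF r'(1) that] by (simp add: poly_H)
      show "degree (H r) \<le> Suc (card {1..k})"
        using deg_H[of r] by (simp add: k(2))
      show "coeff (H r) 0 = 1"
        using G0[OF r'(2)] by (simp add: coeff_H)
    qed simp
    then show ?thesis
      by (simp add: b_def coeff_H k(2))
  qed
  have "\<exists>\<gamma>. H r = (\<Prod>i=1..d. [:1, - \<gamma> i:])" if "r \<ge> 1" for r
    by (rule complex_factorization[OF _ deg_H]) (simp add: coeff_H G0[OF that])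
  then obtain \<gamma> where \<gamma>: "\<And>r. r \<ge> 1 \<Longrightarrow> H r = (\<Prod>i=1..d. [:1, - \<gamma> r i:])"
    by metis
  \<comment> \<open>For the finitely many \<open>r\<close> before \<open>M\<close> any complex factorization serves.\<close>
  define \<beta> where "\<beta> i r = (if r < M then \<gamma> r i
    else if i \<le> k then complex_of_real (inverse (\<xi> i r)) else complex_of_real (b r))" for i r
  have \<beta>_le: "\<beta> i r = complex_of_real (inverse (\<xi> i r))" if "r \<ge> M" "i \<le> k" for i r
    using that by (simp add: \<beta>_def)
  have \<beta>_d: "\<beta> d r = complex_of_real (b r)" if "r \<ge> M" for r
    using that by (simp add: \<beta>_def k(2))
  have product: "H r = (\<Prod>i=1..d. [:1, - \<beta> i r:])" if "r \<ge> 1" for r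
  proof (cases "r < M")
    case True
    then show ?thesis
      using \<gamma>[OF that] by (simp add: \<beta>_def)
  next
    case False
    then have "(\<Prod>i=1..k. [:1, - \<beta> i r:]) = (\<Prod>i=1..k. [:1, - complex_of_real (inverse (\<xi> i r)):])"
      by (intro prod.cong) (auto simp: \<beta>_le)
    moreover have "(\<Prod>i=1..d. [:1, - \<beta> i r:]) = (\<Prod>i=1..k. [:1, - \<beta> i r:]) * [:1, - \<beta> d r:]"
      unfolding k(2) by (subst prod.nat_ivl_Suc', simp, rule mult.commute)
    ultimately show ?thesis
      using factor_real[of r] \<beta>_d[of r] False by (simp only: not_less)
  qed
  have real: "\<beta> i r \<in> \<real>" if "real r > real M" for i r
    using that by (simp add: \<beta>_def)
  have negative: "Re (\<beta> i r) < 0" if "real r > real M" "i \<in> {1..d-1}" for i r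
  proof -
    have r: "r \<ge> M" "r \<ge> N" and i: "i \<in> {1..k}"
      using that by (auto simp: M_def k(2))
    have "Re (\<beta> i r) = inverse (\<xi> i r)"
      using i by (subst \<beta>_le[OF r(1)]) (simp_all only: Re_complex_of_real atLeastAtMost_iff)
    then show ?thesis
      using N(1)[OF r(2) i] by simp
  qed
  have limits: "\<beta> i \<longlonglongrightarrow> complex_of_real (inverse (x i))" if i: "i \<in> {1..d-2}" for i
  proof (rule Lim_transform_eventually)
    have "i \<le> k"
      using i k(2) by auto
    have "x i \<noteq> 0"
      using x(2)[of i] i k(2) by force
    then show "(\<lambda>r. complex_of_real (inverse (\<xi> i r))) \<longlonglongrightarrow> complex_of_real (inverse (x i))"
      by (intro tendsto_of_real tendsto_inverse \<xi>) (use i k(2) in auto)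
    show "\<forall>\<^sub>F r in sequentially. complex_of_real (inverse (\<xi> i r)) = \<beta> i r"
      using eventually_ge_at_top[of M] by eventually_elim (rule \<beta>_le[OF _ \<open>i \<le> k\<close>, symmetric])
  qed
  have diverges: "filterlim (\<lambda>r. Re (\<beta> (d-1) r)) at_bot sequentially"
  proof -
    have "\<forall>\<^sub>F r in sequentially. \<xi> k r < 0"
      using eventually_ge_at_top[of N] by eventually_elim (use N(1) k_in in blast)
    then have lim: "filterlim (\<lambda>r. inverse (\<xi> k r)) at_bot sequentially"
      using \<xi>[OF k_in] x(3) by (intro filterlim_inverse_at_bot) auto
    have "\<forall>\<^sub>F r in sequentially. Re (\<beta> (d-1) r) = inverse (\<xi> k r)"
      using eventually_ge_at_top[of M] by eventually_elim (simp only: \<beta>_le k(2) diff_Suc_1 Re_complex_of_real order_refl)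
    from filterlim_cong[OF refl refl this] lim show ?thesis
      by (rule iffD2)
  qed
  have vanishes: "\<beta> d \<longlonglongrightarrow> 0"
  proof (rule Lim_transform_eventually)
    let ?C = "smult c (eulerian_poly k)"
    \<comment> \<open>In \<open>b\<close> the growing factor \<open>r\<^sup>k\<close> is paired with the zero \<open>\<xi> k r\<close>, so that both products converge; the limit is \<open>0\<close>
      since the Eulerian polynomial has degree below \<open>d\<close>.\<close>
    let ?B = "\<lambda>r. - ((coeff (G r) d / real r ^ k) * ((\<Prod>i\<in>{1..<k}. - \<xi> i r) * - (real r ^ k * \<xi> k r)))"
    have "?B \<longlonglongrightarrow> - (coeff ?C d * ((\<Prod>i\<in>{1..<k}. - x i) * - (- 1 / coeff ?C 1)))"
      by (intro tendsto_mult tendsto_prod tendsto_minus G_lim \<xi>_k \<xi>) auto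
    moreover have "coeff ?C d = 0"
      using deg_p k(2) by (intro coeff_eq_0) simp
    ultimately have "?B \<longlonglongrightarrow> 0"
      by (simp only: mult_zero_left minus_zero)
    from tendsto_of_real[OF this] show "(\<lambda>r. complex_of_real (?B r)) \<longlonglongrightarrow> 0"
      by (simp only: of_real_0)
    show "\<forall>\<^sub>F r in sequentially. complex_of_real (?B r) = \<beta> d r"
      using eventually_ge_at_top[of M]
    proof eventually_elim
      case (elim r)
      have "{1..k} = insert k {1..<k}"
        using k(1) by auto
      then have "b r = ?B r"
        using elim by (simp add: b_def M_def)
      then show ?case
        using \<beta>_d[OF elim] by simp
    qed
  qed
  have "real M > 0"
    by (simp add: M_def)
  then show ?thesis
    unfolding H_def[symmetric]
    by (intro exI[of _ "real M"] exI[of _ \<beta>] conjI allI impI ballI) (rule product real negative limits diverges vanishes | assumption)+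
qed

theorem theorem1p4:
  fixes d :: nat
  assumes "d \<ge> 2"
  shows "\<exists>\<alpha> :: nat \<Rightarrow> real.
    (\<forall>i\<in>{1..d-2}. \<alpha> i < 0) \<and>
    (\<forall>(a :: nat \<Rightarrow> real) (h :: real poly).
       a 0 = 1 \<and> (\<forall>\<^sub>F n in sequentially. a n \<ge> 0) \<and>
       Abs_fps a = fps_of_poly h / (1 - fps_X) ^ d \<and> poly h 1 \<noteq> 0 \<longrightarrow>
       (\<exists>(R :: real) (\<beta> :: nat \<Rightarrow> nat \<Rightarrow> complex). R > 0 \<and>
          (\<forall>r\<ge>1. real r > R \<longrightarrow>
             (\<forall>i\<in>{1..d}. \<beta> i r \<in> \<real>) \<and> (\<forall>i\<in>{1..d-1}. Re (\<beta> i r) < 0)) \<and>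
          (\<forall>i\<in>{1..d-2}. \<beta> i \<longlonglongrightarrow> complex_of_real (\<alpha> i)) \<and>
          filterlim (\<lambda>r. Re (\<beta> (d-1) r)) at_bot sequentially \<and>
          \<beta> d \<longlonglongrightarrow> 0 \<and>
          (\<forall>r\<ge>1. (\<Sum>i=0..d. monom (complex_of_real (coeff (veronese_poly d r h) i)) i)
                  = (\<Prod>i=1..d. [:1, - \<beta> i r:]))))"
proof -
  define k where "k = d - 1"
  have k: "k \<ge> 1" "d = Suc k"
    using assms by (auto simp: k_def)
  obtain x :: "nat \<Rightarrow> real" where x: "inj_on x {1..k}" "\<And>i. i \<in> {1..<k} \<Longrightarrow> x i < 0" "x k = 0"
    "\<And>i. i \<in> {1..k} \<Longrightarrow> poly (eulerian_poly k) (x i) = 0"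
    using eulerian_poly_real_rooted[OF k(1)] by blast
  have "\<forall>i\<in>{1..d-2}. inverse (x i) < 0"
  proof
    fix i assume "i \<in> {1..d-2}"
    then have "i \<in> {1..<k}"
      using k by auto
    then show "inverse (x i) < 0"
      using x(2) by simp
  qed
  then show ?thesis
    by (intro exI[of _ "\<lambda>i. inverse (x i)"] conjI allI impI)
      (assumption, elim conjE, rule veronese_poly_factorization[OF k x])
qed

end
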